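(* The elements $F_0,F_1,\ldots,F_{2n-1}$ form a basis of a subalgebra of the group algebra $\mathbb{Q}[\mathfrak{B}_n]$ (the flag descent algebra). Moreover, this subalgebra is equal to the linear span of the elements $A_0,\ldots,A_{n-1},B_0,\ldots,B_n$.
   Context: Let $n\ge 1$. The hyperoctahedral group $\mathfrak{B}_n$ is the group (under composition of functions) of all bijections $\pi$ of $\{-n,\ldots,-1,0,1,\ldots,n\}$ with $\pi(-i)=-\pi(i)$ for all $i$. For $\pi\in\mathfrak{B}_n$, $\mathrm{des}_A(\pi)=|\{i\in\{1,\ldots,n-1\}:\pi(i)>\pi(i+1)\}|$, $\mathrm{des}_B(\pi)=|\{i\in\{0,\ldots,n-1\}:\pi(i)>\pi(i+1)\}|$ (with $\pi(0)=0$), and $\mathrm{fdes}(\pi)=\mathrm{des}_A(\pi)+\mathrm{des}_B(\pi)$. In $\mathbb{Q}[\mathfrak{B}_n]$ put $$F_i=\sum_{\mathrm{fdes}(\pi)=i}\pi\ (0\le i\le 2n-1),\qquad A_i=\sum_{\mathrm{des}_A(\pi)=i}\pi\ (0\le i\le n-1),\qquad B_i=\sum_{\mathrm{des}_B(\pi)=i}\pi\ (0\le i\le n).$$ The $A_i$ and the $B_i$ are the basis elements of the type $A$ and type $B$ Eulerian descent algebras, respectively. *)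

theory Defs
  imports
    "HOL-Library.Poly_Mapping"
    "HOL-Algebra.Subrings"
    "HOL-Algebra.Sym_Groups"
begin

section \<open>Group algebras over the rationals\<close>

text \<open>
  An element of the group algebra of \<open>G\<close> is a finitely supported function from \<open>carrier G\<close> to the
  rationals. The product is not the multiplication that the library defines on
  \<open>\<Rightarrow>\<^sub>0\<close>: that one convolves along the additive structure of the index type.
\<close>

definition conv ::
    "('g, 'm) monoid_scheme \<Rightarrow> ('g \<Rightarrow>\<^sub>0 rat) \<Rightarrow> ('g \<Rightarrow>\<^sub>0 rat) \<Rightarrow> ('g \<Rightarrow>\<^sub>0 rat)" where
  "conv G x y = (\<Sum>g\<in>Poly_Mapping.keys x. \<Sum>h\<in>Poly_Mapping.keys y.
     Poly_Mapping.single (g \<otimes>\<^bsub>G\<^esub> h) (Poly_Mapping.lookup x g * Poly_Mapping.lookup y h))"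

definition group_algebra :: "('g, 'm) monoid_scheme \<Rightarrow> ('g \<Rightarrow>\<^sub>0 rat) ring" where
  "group_algebra G =
     \<lparr>carrier = {x. Poly_Mapping.keys x \<subseteq> carrier G},
      monoid.mult = conv G,
      monoid.one = Poly_Mapping.single \<one>\<^bsub>G\<^esub> 1,
      ring.zero = 0,
      ring.add = (+)\<rparr>"

abbreviation of_group :: "'g \<Rightarrow> ('g \<Rightarrow>\<^sub>0 rat)" where
  "of_group g \<equiv> Poly_Mapping.single g 1"

definition qscale :: "rat \<Rightarrow> ('g \<Rightarrow>\<^sub>0 rat) \<Rightarrow> ('g \<Rightarrow>\<^sub>0 rat)" where
  "qscale c = Poly_Mapping.map ((*) c)"

lemma lookup_qscale: "Poly_Mapping.lookup (qscale c x) g = c * Poly_Mapping.lookup x g"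
  by (simp add: qscale_def Poly_Mapping.map.rep_eq when_def)

interpretation qvs: vector_space qscale
  by unfold_locales
    (auto intro!: poly_mapping_eqI simp: lookup_qscale lookup_add algebra_simps)

lemma conv_superset:
  assumes "finite A" "Poly_Mapping.keys x \<subseteq> A" "finite B" "Poly_Mapping.keys y \<subseteq> B"
  shows "conv G x y = (\<Sum>g\<in>A. \<Sum>h\<in>B.
     Poly_Mapping.single (g \<otimes>\<^bsub>G\<^esub> h) (Poly_Mapping.lookup x g * Poly_Mapping.lookup y h))"
proof -
  have "conv G x y = (\<Sum>g\<in>Poly_Mapping.keys x. \<Sum>h\<in>B.
     Poly_Mapping.single (g \<otimes>\<^bsub>G\<^esub> h) (Poly_Mapping.lookup x g * Poly_Mapping.lookup y h))"
    unfolding conv_def using assms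
    by (intro sum.cong refl sum.mono_neutral_left) (auto simp: in_keys_iff)
  also have "\<dots> = (\<Sum>g\<in>A. \<Sum>h\<in>B.
     Poly_Mapping.single (g \<otimes>\<^bsub>G\<^esub> h) (Poly_Mapping.lookup x g * Poly_Mapping.lookup y h))"
    using assms by (intro sum.mono_neutral_left) (auto simp: in_keys_iff)
  finally show ?thesis .
qed

lemma conv_add_left: "conv G (x + x') y = conv G x y + conv G x' y"
proof -
  let ?A = "Poly_Mapping.keys x \<union> Poly_Mapping.keys x'" and ?B = "Poly_Mapping.keys y"
  have "Poly_Mapping.keys (x + x') \<subseteq> ?A"
    by (rule Poly_Mapping.keys_add)
  then show ?thesis
    by (simp add: conv_superset[where A = ?A and B = ?B] lookup_add distrib_right
        single_add sum.distrib)
qed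

lemma conv_add_right: "conv G x (y + y') = conv G x y + conv G x y'"
proof -
  let ?A = "Poly_Mapping.keys x" and ?B = "Poly_Mapping.keys y \<union> Poly_Mapping.keys y'"
  have "Poly_Mapping.keys (y + y') \<subseteq> ?B"
    by (rule Poly_Mapping.keys_add)
  then show ?thesis
    by (simp add: conv_superset[where A = ?A and B = ?B] lookup_add distrib_left
        single_add sum.distrib)
qed

lemma conv_zero_left [simp]: "conv G 0 y = 0"
  and conv_zero_right [simp]: "conv G x 0 = 0"
  by (simp_all add: conv_def)

lemma conv_single:
  "conv G (Poly_Mapping.single g a) (Poly_Mapping.single h b) =
     Poly_Mapping.single (g \<otimes>\<^bsub>G\<^esub> h) (a * b)"
  by (subst conv_superset[where A = "{g}" and B = "{h}"]) auto

lemma conv_sum_left: "conv G (sum f I) y = (\<Sum>i\<in>I. conv G (f i) y)"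
  by (induction I rule: infinite_finite_induct) (simp_all add: conv_add_left)

lemma conv_sum_right: "conv G x (sum f I) = (\<Sum>i\<in>I. conv G x (f i))"
  by (induction I rule: infinite_finite_induct) (simp_all add: conv_add_right)

lemma sum_singles:
  "(\<Sum>g\<in>Poly_Mapping.keys x. Poly_Mapping.single g (Poly_Mapping.lookup x g)) = x"
  by (rule poly_mapping_eqI) (simp add: lookup_sum lookup_single when_def in_keys_iff)

lemma keys_conv:
  assumes "group G" "Poly_Mapping.keys x \<subseteq> carrier G" "Poly_Mapping.keys y \<subseteq> carrier G"
  shows "Poly_Mapping.keys (conv G x y) \<subseteq> carrier G"
proof -
  interpret group G by fact
  have "Poly_Mapping.keys (conv G x y) \<subseteq> (\<Union>g\<in>Poly_Mapping.keys x.
     \<Union>h\<in>Poly_Mapping.keys y. {g \<otimes>\<^bsub>G\<^esub> h})"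
    unfolding conv_def
    by (rule order_trans[OF keys_sum] UN_mono order_refl keys_single[THEN eq_refl, THEN order_trans])+
      auto
  then show ?thesis using assms by (auto dest!: subsetD)
qed

lemma conv_assoc:
  assumes "group G" "Poly_Mapping.keys x \<subseteq> carrier G" "Poly_Mapping.keys y \<subseteq> carrier G"
    "Poly_Mapping.keys z \<subseteq> carrier G"
  shows "conv G (conv G x y) z = conv G x (conv G y z)"
proof -
  interpret group G by fact
  let ?s = "\<lambda>x. \<Sum>g\<in>Poly_Mapping.keys x. Poly_Mapping.single g (Poly_Mapping.lookup x g)"
  have xy: "conv G (?s x) (?s y) = (\<Sum>g\<in>Poly_Mapping.keys x. \<Sum>h\<in>Poly_Mapping.keys y.
      Poly_Mapping.single (g \<otimes>\<^bsub>G\<^esub> h) (Poly_Mapping.lookup x g * Poly_Mapping.lookup y h))"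
    for x y
    unfolding conv_sum_left unfolding conv_sum_right conv_single ..
  have "conv G (conv G (?s x) (?s y)) (?s z) =
      (\<Sum>g\<in>Poly_Mapping.keys x. \<Sum>h\<in>Poly_Mapping.keys y. \<Sum>k\<in>Poly_Mapping.keys z.
        Poly_Mapping.single (g \<otimes>\<^bsub>G\<^esub> h \<otimes>\<^bsub>G\<^esub> k)
          (Poly_Mapping.lookup x g * Poly_Mapping.lookup y h * Poly_Mapping.lookup z k))"
    unfolding xy unfolding conv_sum_left unfolding conv_sum_right conv_single ..
  also have "\<dots> = (\<Sum>g\<in>Poly_Mapping.keys x. \<Sum>h\<in>Poly_Mapping.keys y. \<Sum>k\<in>Poly_Mapping.keys z.
        Poly_Mapping.single (g \<otimes>\<^bsub>G\<^esub> (h \<otimes>\<^bsub>G\<^esub> k))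
          (Poly_Mapping.lookup x g * (Poly_Mapping.lookup y h * Poly_Mapping.lookup z k)))"
    using assms(2-4) by (intro sum.cong refl) (simp add: m_assoc subset_iff mult.assoc)
  also have "\<dots> = conv G (?s x) (conv G (?s y) (?s z))"
    unfolding xy unfolding conv_sum_left unfolding conv_sum_right conv_single ..
  finally show ?thesis by (simp only: sum_singles)
qed

lemma conv_one:
  assumes "group G" "Poly_Mapping.keys x \<subseteq> carrier G"
  shows "conv G (of_group \<one>\<^bsub>G\<^esub>) x = x" "conv G x (of_group \<one>\<^bsub>G\<^esub>) = x"
proof -
  interpret group G by fact
  let ?s = "\<Sum>g\<in>Poly_Mapping.keys x. Poly_Mapping.single g (Poly_Mapping.lookup x g)"
  have "conv G (of_group \<one>\<^bsub>G\<^esub>) ?s = ?s" "conv G ?s (of_group \<one>\<^bsub>G\<^esub>) = ?s"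
    unfolding conv_sum_left conv_sum_right conv_single
    using assms(2) by (auto intro!: sum.cong)
  then show "conv G (of_group \<one>\<^bsub>G\<^esub>) x = x" "conv G x (of_group \<one>\<^bsub>G\<^esub>) = x"
    by (simp_all only: sum_singles)
qed

lemma ring_group_algebra:
  assumes "group G"
  shows "ring (group_algebra G)"
proof -
  interpret group G by fact
  show ?thesis
  proof (rule ringI)
    show "abelian_group (group_algebra G)"
    proof (rule abelian_groupI)
      fix x assume "x \<in> carrier (group_algebra G)"
      then show "\<exists>y\<in>carrier (group_algebra G).
          y \<oplus>\<^bsub>group_algebra G\<^esub> x = \<zero>\<^bsub>group_algebra G\<^esub>"
        by (intro bexI[of _ "- x"]) (auto simp: group_algebra_def)
    next
      fix x y assume "x \<in> carrier (group_algebra G)" "y \<in> carrier (group_algebra G)"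
      then show "x \<oplus>\<^bsub>group_algebra G\<^esub> y \<in> carrier (group_algebra G)"
        using Poly_Mapping.keys_add[of x y] by (auto simp: group_algebra_def)
    qed (auto simp: group_algebra_def algebra_simps)
    show "monoid (group_algebra G)"
      by (rule monoidI)
        (simp_all add: group_algebra_def keys_conv conv_assoc conv_one \<open>group G\<close>)
  qed (simp_all add: group_algebra_def conv_add_left conv_add_right)
qed

text \<open>A subalgebra contains the identity of the group algebra (part of \<^const>\<open>subring\<close>).\<close>

definition ga_subalgebra :: "('g, 'm) monoid_scheme \<Rightarrow> ('g \<Rightarrow>\<^sub>0 rat) set \<Rightarrow> bool" where
  "ga_subalgebra G S \<longleftrightarrow> subring S (group_algebra G) \<and> qvs.subspace S"

text \<open>Basis as an indexed family, so the members are in particular pairwise distinct.\<close>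

definition basis_family :: "('i \<Rightarrow> ('g \<Rightarrow>\<^sub>0 rat)) \<Rightarrow> 'i set \<Rightarrow> ('g \<Rightarrow>\<^sub>0 rat) set \<Rightarrow> bool" where
  "basis_family f I S \<longleftrightarrow> inj_on f I \<and> qvs.independent (f ` I) \<and> qvs.span (f ` I) = S"


section \<open>The hyperoctahedral group and its descent statistics\<close>

text \<open>
  As for \<^const>\<open>sym_group\<close>, bijections of \<open>{-n..n}\<close> are represented by functions on all integers
  that are the identity elsewhere.
\<close>

definition hyperoctahedral :: "nat \<Rightarrow> (int \<Rightarrow> int) monoid" where
  "hyperoctahedral n =
     \<lparr>carrier = {\<pi>. \<pi> permutes {- int n..int n} \<and> (\<forall>i\<in>{- int n..int n}. \<pi> (- i) = - \<pi> i)},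
      monoid.mult = (\<circ>),
      one = id\<rparr>"

lemma group_hyperoctahedral: "group (hyperoctahedral n)"
proof (rule groupI)
  fix \<pi> assume \<pi>: "\<pi> \<in> carrier (hyperoctahedral n)"
  then have p: "\<pi> permutes {- int n..int n}"
    and odd: "\<And>i. i \<in> {- int n..int n} \<Longrightarrow> \<pi> (- i) = - \<pi> i"
    by (auto simp: hyperoctahedral_def)
  have q: "inv' \<pi> permutes {- int n..int n}"
    using p by (rule permutes_inv)
  have "inv' \<pi> (- i) = - inv' \<pi> i" if "i \<in> {- int n..int n}" for i
  proof -
    have "inv' \<pi> i \<in> {- int n..int n}"
      using permutes_in_image[OF q] that by blast
    from odd[OF this] have "\<pi> (- inv' \<pi> i) = - i"
      by (simp add: permutes_inverses(1)[OF p])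
    then show ?thesis
      by (metis permutes_inverses(2)[OF p])
  qed
  with q have "inv' \<pi> \<in> carrier (hyperoctahedral n)"
    by (simp add: hyperoctahedral_def)
  moreover have "inv' \<pi> \<circ> \<pi> = id"
    using p by (rule permutes_inv_o)
  ultimately show "\<exists>\<sigma>\<in>carrier (hyperoctahedral n).
      \<sigma> \<otimes>\<^bsub>hyperoctahedral n\<^esub> \<pi> = \<one>\<^bsub>hyperoctahedral n\<^esub>"
    by (auto simp: hyperoctahedral_def)
next
  fix \<pi> \<sigma> assume a: "\<pi> \<in> carrier (hyperoctahedral n)" "\<sigma> \<in> carrier (hyperoctahedral n)"
  then have s: "\<sigma> permutes {- int n..int n}"
    by (simp add: hyperoctahedral_def)
  have "\<pi> (\<sigma> (- i)) = - \<pi> (\<sigma> i)" if "i \<in> {- int n..int n}" for i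
  proof -
    have "\<sigma> i \<in> {- int n..int n}"
      using permutes_in_image[OF s] that by blast
    with a that show ?thesis by (simp add: hyperoctahedral_def)
  qed
  with a show "\<pi> \<otimes>\<^bsub>hyperoctahedral n\<^esub> \<sigma> \<in> carrier (hyperoctahedral n)"
    by (simp add: hyperoctahedral_def permutes_compose)
qed (auto simp: hyperoctahedral_def permutes_id o_assoc)

definition des_A :: "nat \<Rightarrow> (int \<Rightarrow> int) \<Rightarrow> nat" where
  "des_A n \<pi> = card {i \<in> {1..int n - 1}. \<pi> i > \<pi> (i + 1)}"

definition des_B :: "nat \<Rightarrow> (int \<Rightarrow> int) \<Rightarrow> nat" where
  "des_B n \<pi> = card {i \<in> {0..int n - 1}. \<pi> i > \<pi> (i + 1)}"

definition fdes :: "nat \<Rightarrow> (int \<Rightarrow> int) \<Rightarrow> nat" where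
  "fdes n \<pi> = des_A n \<pi> + des_B n \<pi>"

definition F_elem :: "nat \<Rightarrow> nat \<Rightarrow> ((int \<Rightarrow> int) \<Rightarrow>\<^sub>0 rat)" where
  "F_elem n i = (\<Sum>\<pi> | \<pi> \<in> carrier (hyperoctahedral n) \<and> fdes n \<pi> = i. of_group \<pi>)"

definition A_elem :: "nat \<Rightarrow> nat \<Rightarrow> ((int \<Rightarrow> int) \<Rightarrow>\<^sub>0 rat)" where
  "A_elem n i = (\<Sum>\<pi> | \<pi> \<in> carrier (hyperoctahedral n) \<and> des_A n \<pi> = i. of_group \<pi>)"

definition B_elem :: "nat \<Rightarrow> nat \<Rightarrow> ((int \<Rightarrow> int) \<Rightarrow>\<^sub>0 rat)" where
  "B_elem n i = (\<Sum>\<pi> | \<pi> \<in> carrier (hyperoctahedral n) \<and> des_B n \<pi> = i. of_group \<pi>)"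

text \<open>The sums above range over finite sets, so they are not silently \<open>0\<close>.\<close>

lemma finite_hyperoctahedral: "finite (carrier (hyperoctahedral n))"
  by (rule finite_subset[OF _ finite_permutations[of "{- int n..int n}"]])
    (auto simp: hyperoctahedral_def)

end

(*
  For x >= 1 let X_x = {-(x-1), -(x-3), ..., x-1}, a set of x integers closed under negation. An odd
  word w of length n over X_x is sorted by a unique signed permutation, its standardisation: the pi
  for which the pairs (w(pi i), pi i) increase lexicographically. Let Phi_x be the sum of the
  standardisations of all such words.

  Since (a, b) |-> x a + b is an isomorphism of the lexicographic order on X_y x X_x with X_{xy}
  that commutes with negation, Phi_x Phi_y = Phi_{xy}, and Phi_1 is the identity. So the span of the
  Phi_x is a subalgebra.

  The words sorted by a given pi correspond to sequences 0 <= a_1 <= ... <= a_n <= x-1 in X_x, where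
  a_i < a_{i+1} at descents and 0 < a_1 if pi 1 < 0. Subtracting from a_i the flag descent number of
  pi 1, ..., pi i makes all inequalities weak and all entries congruent to x-1-fdes(pi) modulo 2, so
  their number depends only on x-1-fdes(pi); it is 0 if that is negative and 1 if it is 0. Hence the
  Phi_x are unitriangular combinations of the F_i, and both families have the same span. Finally
  A_k = F_{2k} + F_{2k+1} and B_k = F_{2k-1} + F_{2k}.
*)
theory Submission
  imports Defs
begin

section \<open>Signed permutations\<close>

lemma hyperoctahedralD:
  assumes "\<pi> \<in> carrier (hyperoctahedral n)"
  shows "\<pi> permutes {- int n..int n}" "\<And>i. \<pi> (- i) = - \<pi> i" "\<pi> 0 = 0"
proof -
  show p: "\<pi> permutes {- int n..int n}"
    using assms by (simp add: hyperoctahedral_def)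
  show odd: "\<pi> (- i) = - \<pi> i" for i
  proof (cases "i \<in> {- int n..int n}")
    case True
    then show ?thesis using assms by (simp add: hyperoctahedral_def)
  next
    case False
    then have "- i \<notin> {- int n..int n}" by auto
    with False show ?thesis using permutes_not_in[OF p] by metis
  qed
  show "\<pi> 0 = 0" using odd[of 0] by simp
qed

lemma hyperoctahedral_image:
  assumes "\<pi> \<in> carrier (hyperoctahedral n)"
  shows "\<bar>\<pi> i\<bar> \<le> int n \<longleftrightarrow> \<bar>i\<bar> \<le> int n"
  using permutes_in_image[OF hyperoctahedralD(1)[OF assms], of i] by auto

lemma hyperoctahedral_eq_iff:
  assumes "\<pi> \<in> carrier (hyperoctahedral n)"
  shows "\<pi> i = \<pi> j \<longleftrightarrow> i = j"
  using permutes_inj[OF hyperoctahedralD(1)[OF assms]] by (auto dest: injD)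

lemma hyperoctahedral_comp:
  assumes "\<pi> \<in> carrier (hyperoctahedral n)" "\<sigma> \<in> carrier (hyperoctahedral n)"
  shows "\<pi> \<circ> \<sigma> \<in> carrier (hyperoctahedral n)"
  using group.subgroup_self[OF group_hyperoctahedral, of n, THEN subgroup.m_closed, OF assms]
  by (simp add: hyperoctahedral_def)

lemma hyperoctahedralI:
  assumes "\<pi> permutes {- int n..int n}" "\<And>i. \<pi> (- i) = - \<pi> i"
  shows "\<pi> \<in> carrier (hyperoctahedral n)"
  using assms by (simp add: hyperoctahedral_def)

lemma hyperoctahedral_inv:
  assumes "\<pi> \<in> carrier (hyperoctahedral n)"
  shows "inv' \<pi> \<in> carrier (hyperoctahedral n)"
proof (rule hyperoctahedralI)
  note p = hyperoctahedralD(1)[OF assms]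
  show "inv' \<pi> permutes {- int n..int n}" using p by (rule permutes_inv)
  show "inv' \<pi> (- i) = - inv' \<pi> i" for i
    by (metis hyperoctahedralD(2)[OF assms] permutes_inverses[OF p])
qed

section \<open>Words and standardisation\<close>

text \<open>
  Being odd, a word has the value \<open>0\<close> at \<open>0\<close>, even when the parity condition excludes \<open>0\<close> from the
  alphabet.
\<close>

definition words :: "nat \<Rightarrow> nat \<Rightarrow> (int \<Rightarrow> int) set" where
  "words n x = {w. (\<forall>i. w (- i) = - w i) \<and> (\<forall>i>int n. w i = 0) \<and>
     (\<forall>i\<in>{1..int n}. \<bar>w i\<bar> < int x \<and> odd (w i + int x))}"

lemma words_zero [simp]: "w \<in> words n x \<Longrightarrow> w 0 = 0"
  by (auto simp: words_def dest: spec[of _ 0])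

lemma words_minus: "w \<in> words n x \<Longrightarrow> w (- i) = - w i"
  by (simp add: words_def)

lemma words_outside: "w \<in> words n x \<Longrightarrow> \<bar>i\<bar> > int n \<Longrightarrow> w i = 0"
  by (cases "i > 0") (auto simp: words_def dest: spec[of _ "- i"])

text \<open>The value 0 at position 0 and outside need not be a letter: it meets the bound as soon
  as \<open>x > 0\<close>, but the parity is guaranteed only at the true positions.\<close>

lemma words_bound: "w \<in> words n x \<Longrightarrow> x > 0 \<Longrightarrow> \<bar>w i\<bar> < int x"
  and words_parity: "w \<in> words n x \<Longrightarrow> i \<noteq> 0 \<Longrightarrow> \<bar>i\<bar> \<le> int n \<Longrightarrow> odd (w i + int x)"
proof -
  assume w: "w \<in> words n x"
  show "\<bar>w i\<bar> < int x" if "x > 0"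
  proof -
    consider "i \<in> {1..int n}" | "- i \<in> {1..int n}" | "i = 0" | "\<bar>i\<bar> > int n" by fastforce
    then show ?thesis
    proof cases
      case 2
      then have "\<bar>w (- i)\<bar> < int x" using w unfolding words_def by blast
      then show ?thesis by (simp add: words_minus[OF w])
    qed (use w words_zero[OF w] words_outside[OF w] that in \<open>auto simp: words_def simp del: words_zero\<close>)
  qed
  show "odd (w i + int x)" if "i \<noteq> 0" "\<bar>i\<bar> \<le> int n"
  proof (cases "i > 0")
    case False
    with that have "- i \<in> {1..int n}" by auto
    then have "odd (w (- i) + int x)" using w unfolding words_def by blast
    then show ?thesis by (simp add: words_minus[OF w])
  qed (use w that in \<open>auto simp: words_def\<close>)
qed

definition odd_ext :: "nat \<Rightarrow> (int \<Rightarrow> int) \<Rightarrow> int \<Rightarrow> int" where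
  "odd_ext n g i = (if i \<in> {1..int n} then g i else if - i \<in> {1..int n} then - g (- i) else 0)"

lemma odd_ext_words:
  assumes "\<And>i. i \<in> {1..int n} \<Longrightarrow> \<bar>g i\<bar> < int x \<and> odd (g i + int x)"
  shows "odd_ext n g \<in> words n x"
  using assms by (auto simp: words_def odd_ext_def)

lemma odd_ext_eq:
  assumes "w \<in> words n x" "\<And>i. i \<in> {1..int n} \<Longrightarrow> g i = w i"
  shows "odd_ext n g = w"
proof
  fix i
  consider "i \<in> {1..int n}" | "- i \<in> {1..int n}" | "i = 0" | "\<bar>i\<bar> > int n" by fastforce
  then show "odd_ext n g i = w i"
  proof cases
    case 2
    then show ?thesis using assms(2)[of "- i"] words_minus[OF assms(1), of i]
      by (auto simp: odd_ext_def)
  qed (use assms words_outside[OF assms(1)] in \<open>auto simp: odd_ext_def\<close>)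
qed

lemma words_eqI:
  assumes "w \<in> words n x" "w' \<in> words n y" "\<And>i. i \<in> {1..int n} \<Longrightarrow> w i = w' i"
  shows "w = w'"
proof
  fix i
  consider "i \<in> {1..int n}" | "- i \<in> {1..int n}" | "i = 0" | "\<bar>i\<bar> > int n" by fastforce
  then show "w i = w' i"
  proof cases
    case 2
    then have "w (- i) = w' (- i)" by (rule assms(3))
    then show ?thesis by (simp add: words_minus[OF assms(1)] words_minus[OF assms(2)])
  qed (use assms words_outside[OF assms(1)] words_outside[OF assms(2)] in auto)
qed

text \<open>The alphabet is closed under negation and a signed permutation keeps nonzero positions
  nonzero, so only true letters are moved into place.\<close>

lemma words_comp:
  assumes "w \<in> words n x" and \<pi>: "\<pi> \<in> carrier (hyperoctahedral n)"
  shows "w \<circ> \<pi> \<in> words n x"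
proof -
  have "w (\<pi> i) = 0" if "i > int n" for i
    using words_outside[OF assms(1), of "\<pi> i"] hyperoctahedral_image[OF \<pi>, of i] that by auto
  moreover have "\<bar>w (\<pi> i)\<bar> < int x \<and> odd (w (\<pi> i) + int x)" if i: "i \<in> {1..int n}" for i
  proof -
    have "\<pi> i \<noteq> 0"
      using hyperoctahedral_eq_iff[OF \<pi>, of i 0] hyperoctahedralD(3)[OF \<pi>] i by auto
    moreover have "\<bar>\<pi> i\<bar> \<le> int n" using hyperoctahedral_image[OF \<pi>, of i] i by auto
    moreover from calculation consider "\<pi> i \<in> {1..int n}" | "- \<pi> i \<in> {1..int n}" by fastforce
    then have "\<bar>w (\<pi> i)\<bar> < int x"
    proof cases
      case 2
      then have "\<bar>w (- \<pi> i)\<bar> < int x" using assms(1) unfolding words_def by blast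
      then show ?thesis by (simp add: words_minus[OF assms(1)])
    qed (use assms(1) in \<open>auto simp: words_def\<close>)
    ultimately show ?thesis using words_parity[OF assms(1)] by blast
  qed
  ultimately show ?thesis
    using assms(1) by (simp add: words_def hyperoctahedralD(2)[OF \<pi>])
qed

lemma finite_words: "finite (words n x)"
proof (rule finite_subset)
  show "words n x \<subseteq> {w. \<forall>i. (i \<in> {- int n..int n} \<longrightarrow> w i \<in> {- int x..int x}) \<and>
      (i \<notin> {- int n..int n} \<longrightarrow> w i = 0)}"
  proof (intro subsetI CollectI allI conjI impI)
    fix w i assume w: "w \<in> words n x"
    { assume "i \<in> {- int n..int n}"
      show "w i \<in> {- int x..int x}"
      \<comment> \<open>For \<open>x = 0\<close> the alphabet is empty, so a word exists only for
        \<open>n = 0\<close>, where position 0 is all that remains.\<close>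
      proof (cases "x = 0")
        case True
        with w have "n = 0" by (force simp: words_def dest: bspec[of _ _ 1])
        then show ?thesis using \<open>i \<in> {- int n..int n}\<close> w by auto
      next
        case False
        then show ?thesis using words_bound[OF w, of i] by auto
      qed }
    { assume "i \<notin> {- int n..int n}"
      then show "w i = 0" using words_outside[OF w, of i] by auto }
  qed
qed (rule finite_set_of_finite_funs; simp)

section \<open>The lexicographic order on positions and its ranks\<close>

definition word_less :: "(int \<Rightarrow> int) \<Rightarrow> int \<Rightarrow> int \<Rightarrow> bool" where
  "word_less w i j \<longleftrightarrow> w i < w j \<or> w i = w j \<and> i < j"

lemma word_less_trans: "word_less w i j \<Longrightarrow> word_less w j k \<Longrightarrow> word_less w i k"
  and word_less_irrefl: "\<not> word_less w i i"
  and word_less_linear: "i \<noteq> j \<Longrightarrow> word_less w i j \<or> word_less w j i"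
  by (auto simp: word_less_def)

text \<open>Negating a position negates letter and position alike, which reverses the lexicographic
  order.\<close>

lemma word_less_minus:
  "(\<And>i. w (- i) = - w i) \<Longrightarrow> word_less w (- i) (- j) \<longleftrightarrow> word_less w j i"
  by (auto simp: word_less_def)

text \<open>Comparisons at nonnegative places suffice because words are odd. The one at place 0
  makes \<open>w (\<pi> 1)\<close> nonnegative, and \<open>\<pi> 1\<close> positive if that letter
  is 0.\<close>

definition sorts :: "nat \<Rightarrow> (int \<Rightarrow> int) \<Rightarrow> (int \<Rightarrow> int) \<Rightarrow> bool" where
  "sorts n w \<pi> \<longleftrightarrow> \<pi> \<in> carrier (hyperoctahedral n) \<and>
     (\<forall>i\<in>{0..<int n}. word_less w (\<pi> i) (\<pi> (i + 1)))"

lemma sorts_mono: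
  assumes "sorts n w \<pi>" and odd: "\<And>i. w (- i) = - w i" and "- int n \<le> i" "i < j" "j \<le> int n"
  shows "word_less w (\<pi> i) (\<pi> j)"
proof -
  have \<pi>: "\<pi> \<in> carrier (hyperoctahedral n)" using assms by (simp add: sorts_def)
  have step: "word_less w (\<pi> k) (\<pi> (k + 1))" if "- int n \<le> k" "k < int n" for k
  proof (cases "k \<ge> 0")
    case True
    with that assms(1) show ?thesis by (simp add: sorts_def)
  next
    case False
    \<comment> \<open>A comparison at a negative place is the reflection of the one at the
      nonnegative place \<open>- (k + 1)\<close>.\<close>
    then have "- (k + 1) \<in> {0..<int n}" using that by auto
    then have "word_less w (\<pi> (- (k + 1))) (\<pi> (- (k + 1) + 1))"
      using assms(1) unfolding sorts_def by blast
    moreover have "- (k + 1) + 1 = - k" by simp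
    ultimately have "word_less w (- \<pi> (k + 1)) (- \<pi> k)"
      by (simp only: hyperoctahedralD(2)[OF \<pi>])
    then show ?thesis by (simp add: word_less_minus[of w, OF odd])
  qed
  have "j \<le> int n \<longrightarrow> word_less w (\<pi> i) (\<pi> j)"
    using \<open>i < j\<close>
  proof (induction rule: int_gr_induct)
    case base
    then show ?case using step[of i] assms by auto
  next
    case (step k)
    then show ?case using \<open>\<And>k. - int n \<le> k \<Longrightarrow> k < int n \<Longrightarrow> _\<close>[of k] assms(3)
      by (auto intro: word_less_trans)
  qed
  then show ?thesis using assms by blast
qed

text \<open>The number of smaller positions runs from 0 to 2n; subtracting n centres it, so that
  negating a position can negate its rank. The identity outside is what \<open>permutes\<close>
  demands.\<close>

definition word_rank :: "nat \<Rightarrow> (int \<Rightarrow> int) \<Rightarrow> int \<Rightarrow> int" where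
  "word_rank n w i = (if \<bar>i\<bar> \<le> int n
     then int (card {j \<in> {- int n..int n}. word_less w j i}) - int n else i)"

lemma word_rank_less:
  assumes "word_less w i j" "\<bar>i\<bar> \<le> int n" "\<bar>j\<bar> \<le> int n"
  shows "word_rank n w i < word_rank n w j"
proof -
  have "i \<in> {k \<in> {- int n..int n}. word_less w k j}" using assms by auto
  moreover have "i \<notin> {k \<in> {- int n..int n}. word_less w k i}" by (simp add: word_less_irrefl)
  moreover have "{k \<in> {- int n..int n}. word_less w k i} \<subseteq> {k \<in> {- int n..int n}. word_less w k j}"
    using assms(1) by (auto intro: word_less_trans)
  ultimately have "{k \<in> {- int n..int n}. word_less w k i} \<subset> {k \<in> {- int n..int n}. word_less w k j}"
    by blast
  then have "card {k \<in> {- int n..int n}. word_less w k i} < card {k \<in> {- int n..int n}. word_less w k j}"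
    by (intro psubset_card_mono) (simp_all del: atLeastAtMost_iff)
  then show ?thesis using assms by (simp add: word_rank_def)
qed

text \<open>Distinct positions have distinct ranks by linearity, so the rank permutes the finite
  set. Negation swaps the positions below and above i, whose numbers add up to 2n; after centring,
  the two ranks are opposite.\<close>

lemma word_rank_hyperoctahedral:
  assumes odd: "\<And>i. w (- i) = - w i"
  shows "word_rank n w \<in> carrier (hyperoctahedral n)"
proof (rule hyperoctahedralI)
  let ?I = "{- int n..int n}"
  have inj: "inj_on (word_rank n w) ?I"
  proof (rule inj_onI)
    fix i j assume "i \<in> ?I" "j \<in> ?I" "word_rank n w i = word_rank n w j"
    then show "i = j"
      using word_rank_less[of w i j n] word_rank_less[of w j i n] word_less_linear[of i j w]
      by fastforce
  qed
  have "word_rank n w ` ?I \<subseteq> ?I"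
  proof (rule image_subsetI)
    fix i assume i: "i \<in> ?I"
    have "card {j \<in> ?I. word_less w j i} \<le> card (?I - {i})"
      by (intro card_mono) (auto simp: word_less_irrefl)
    also have "\<dots> = 2 * n" using i by (simp add: nat_add_distrib)
    finally show "word_rank n w i \<in> ?I" using i by (auto simp: word_rank_def)
  qed
  then have "word_rank n w ` ?I = ?I"
    by (intro card_subset_eq) (auto simp: card_image[OF inj])
  then show "word_rank n w permutes ?I"
    using inj by (intro bij_imp_permutes) (auto simp: bij_betw_def word_rank_def)
  fix i
  show "word_rank n w (- i) = - word_rank n w i"
  proof (cases "\<bar>i\<bar> \<le> int n")
    case True
    let ?L = "{j \<in> ?I. word_less w j i}" and ?G = "{j \<in> ?I. word_less w i j}"
    have "card {j \<in> ?I. word_less w j (- i)} = card ?G"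
    proof (rule bij_betw_same_card[of uminus])
      show "bij_betw uminus {j \<in> ?I. word_less w j (- i)} ?G"
        by (rule bij_betwI[where g = uminus])
          (auto simp: word_less_minus[of w, OF odd] dest: word_less_minus[of w, OF odd, THEN iffD2])
    qed
    moreover have "card ?L + card ?G = 2 * n"
    proof -
      have "card ?L + card ?G = card (?L \<union> ?G)"
        by (rule card_Un_disjoint[symmetric]) (auto dest: word_less_trans simp: word_less_irrefl simp del: atLeastAtMost_iff)
      also have "?L \<union> ?G = ?I - {i}"
        using word_less_linear[of _ i w] by (auto simp: word_less_irrefl)
      also have "card \<dots> = 2 * n"
      proof -
        have "i \<in> ?I" using True by auto
        then show ?thesis by (simp add: nat_add_distrib)
      qed
      finally show ?thesis .
    qed
    ultimately show ?thesis using True by (simp add: word_rank_def)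
  qed (simp add: word_rank_def)
qed

text \<open>The positions below \<open>\<pi> i\<close> are the images of the i + n places before i.
  So the rank inverts every sorting permutation, which will give uniqueness.\<close>

lemma word_rank_sorts:
  assumes "sorts n w \<pi>" and odd: "\<And>i. w (- i) = - w i"
  shows "word_rank n w (\<pi> i) = i"
proof (cases "\<bar>i\<bar> \<le> int n")
  case True
  have \<pi>: "\<pi> \<in> carrier (hyperoctahedral n)" using assms by (simp add: sorts_def)
  note p = hyperoctahedralD(1)[OF \<pi>]
  note mono = sorts_mono[OF assms(1), OF odd]
  have "{j \<in> {- int n..int n}. word_less w j (\<pi> i)} = \<pi> ` {- int n..<i}"
  proof (intro equalityI subsetI)
    fix j assume j: "j \<in> {j \<in> {- int n..int n}. word_less w j (\<pi> i)}"
    then obtain k where k: "j = \<pi> k" "k \<in> {- int n..int n}"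
      using permutes_image[OF p] by blast
    have "\<not> i < k" using mono[of i k] True k j word_less_trans[of w "\<pi> i" "\<pi> k" "\<pi> i"]
      by (auto simp: word_less_irrefl)
    moreover have "k \<noteq> i" using j k by (auto simp: word_less_irrefl)
    ultimately show "j \<in> \<pi> ` {- int n..<i}" using k by auto
  next
    fix j assume "j \<in> \<pi> ` {- int n..<i}"
    then obtain k where k: "j = \<pi> k" "- int n \<le> k" "k < i" by auto
    have "\<bar>\<pi> k\<bar> \<le> int n" using hyperoctahedral_image[OF \<pi>, of k] k True by auto
    then show "j \<in> {j \<in> {- int n..int n}. word_less w j (\<pi> i)}"
      using mono[of k i] k True by auto
  qed
  moreover have "card (\<pi> ` {- int n..<i}) = nat (i + int n)"
    by (subst card_image) (auto intro: inj_onI simp: hyperoctahedral_eq_iff[OF \<pi>])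
  moreover have "\<bar>\<pi> i\<bar> \<le> int n" using hyperoctahedral_image[OF \<pi>] True by blast
  ultimately show ?thesis using True by (simp add: word_rank_def)
next
  case False
  have \<pi>: "\<pi> \<in> carrier (hyperoctahedral n)" using assms by (simp add: sorts_def)
  moreover have "i \<notin> {- int n..int n}" using False by auto
  ultimately have "\<pi> i = i" using permutes_not_in[OF hyperoctahedralD(1)] by blast
  with False show ?thesis by (simp add: word_rank_def)
qed

text \<open>The rank sends a position to its place in sorted order, whereas the sorting permutation
  sends places to positions.\<close>

definition std :: "nat \<Rightarrow> (int \<Rightarrow> int) \<Rightarrow> int \<Rightarrow> int" where
  "std n w = inv' (word_rank n w)"

lemma std_hyperoctahedral:
  "w \<in> words n x \<Longrightarrow> std n w \<in> carrier (hyperoctahedral n)"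
  unfolding std_def by (intro hyperoctahedral_inv word_rank_hyperoctahedral words_minus)

lemma sorts_std:
  assumes "w \<in> words n x"
  shows "sorts n w (std n w)"
  unfolding sorts_def
proof (intro conjI ballI std_hyperoctahedral[OF assms])
  let ?\<sigma> = "std n w"
  have r: "word_rank n w \<in> carrier (hyperoctahedral n)"
    using words_minus[OF assms] by (rule word_rank_hyperoctahedral)
  have id: "word_rank n w (?\<sigma> j) = j" for j
    unfolding std_def by (rule permutes_inverses(1)[OF hyperoctahedralD(1)[OF r]])
  fix i assume i: "i \<in> {0..<int n}"
  have "\<bar>?\<sigma> i\<bar> \<le> int n" "\<bar>?\<sigma> (i + 1)\<bar> \<le> int n"
    using i hyperoctahedral_image[OF std_hyperoctahedral[OF assms]] by auto
  then have "\<not> word_less w (?\<sigma> (i + 1)) (?\<sigma> i)"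
    using word_rank_less[of w "?\<sigma> (i + 1)" "?\<sigma> i" n] by (auto simp: id)
  moreover have "?\<sigma> i \<noteq> ?\<sigma> (i + 1)" using id[of i] id[of "i + 1"] by auto
  ultimately show "word_less w (?\<sigma> i) (?\<sigma> (i + 1))" using word_less_linear by blast
qed

text \<open>Existence is \<open>sorts_std\<close>; any two sorting permutations are inverted by the
  same injective rank, so they agree.\<close>

lemma std_eq_iff:
  assumes "w \<in> words n x"
  shows "std n w = \<pi> \<longleftrightarrow> sorts n w \<pi>"
proof
  assume \<pi>: "sorts n w \<pi>"
  note odd = words_minus[OF assms]
  have "word_rank n w (\<pi> i) = word_rank n w (std n w i)" for i
    using word_rank_sorts[OF \<pi>, of i, OF odd] word_rank_sorts[OF sorts_std[OF assms], of i, OF odd]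
    by simp
  then show "std n w = \<pi>"
    using hyperoctahedral_eq_iff[OF word_rank_hyperoctahedral[of w n, OF odd]] by auto
qed (use sorts_std[OF assms] in auto)


section \<open>Multiplicativity\<close>

definition Phi :: "nat \<Rightarrow> nat \<Rightarrow> ((int \<Rightarrow> int) \<Rightarrow>\<^sub>0 rat)" where
  "Phi n x = (\<Sum>w\<in>words n x. of_group (std n w))"

text \<open>
  The inverse of \<open>std n u\<close> realigns \<open>v\<close> so that the pair is sorted by \<open>std n u \<circ> std n v\<close>: first by \<open>v\<close>,
  ties being broken by \<open>u\<close>.
\<close>

definition word_pair :: "nat \<Rightarrow> nat \<Rightarrow> (int \<Rightarrow> int) \<Rightarrow> (int \<Rightarrow> int) \<Rightarrow> int \<Rightarrow> int" where
  "word_pair n x u v i = int x * v (inv' (std n u) i) + u i"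

context
  fixes n x y :: nat
  assumes pos: "x > 0" "y > 0"
begin

text \<open>With digits a and b, the absolute value is at most x (y - 1) + (x - 1) < x y, and x a +
  b + x y = x (a + y) + b is odd because a + y and b + x are.\<close>

lemma word_pair_words:
  assumes u: "u \<in> words n x" and v: "v \<in> words n y"
  shows "word_pair n x u v \<in> words n (x * y)"
proof -
  let ?r = "inv' (std n u)"
  have r: "?r \<in> carrier (hyperoctahedral n)"
    using std_hyperoctahedral[OF u] by (rule hyperoctahedral_inv)
  have "word_pair n x u v (- i) = - word_pair n x u v i" for i
    by (simp add: word_pair_def hyperoctahedralD(2)[OF r] words_minus[OF u] words_minus[OF v])
  moreover have "word_pair n x u v i = 0" if "i > int n" for i
  proof -
    have "\<bar>?r i\<bar> > int n" using hyperoctahedral_image[OF r, of i] that by auto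
    then show ?thesis
      using that by (simp add: word_pair_def words_outside[OF v] words_outside[OF u])
  qed
  moreover have "\<bar>word_pair n x u v i\<bar> < int (x * y) \<and> odd (word_pair n x u v i + int (x * y))"
    if i: "i \<in> {1..int n}" for i
  proof
    have "\<bar>v (?r i)\<bar> \<le> int y - 1" using words_bound[OF v pos(2), of "?r i"] by simp
    then have "int x * \<bar>v (?r i)\<bar> \<le> int x * (int y - 1)" by (intro mult_left_mono) auto
    moreover have "\<bar>word_pair n x u v i\<bar> \<le> int x * \<bar>v (?r i)\<bar> + \<bar>u i\<bar>"
      unfolding word_pair_def by (rule order_trans[OF abs_triangle_ineq]) (simp add: abs_mult)
    ultimately show "\<bar>word_pair n x u v i\<bar> < int (x * y)"
      using words_bound[OF u pos(1), of i] by (simp add: algebra_simps)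
    have "?r i \<noteq> 0"
      using hyperoctahedral_eq_iff[OF r, of i 0] hyperoctahedralD(3)[OF r] i by auto
    moreover have "\<bar>?r i\<bar> \<le> int n" using hyperoctahedral_image[OF r, of i] i by auto
    ultimately have "odd (v (?r i) + int y)" by (rule words_parity[OF v])
    moreover have "odd (u i + int x)" using words_parity[OF u, of i] i by auto
    ultimately show "odd (word_pair n x u v i + int (x * y))"
      by (auto simp: word_pair_def)
  qed
  ultimately show ?thesis by (simp add: words_def)
qed

text \<open>Read along \<open>std n u\<close>, the high digits are just v, and they decide unless
  they tie. \<open>std n v\<close> breaks a tie by j < k, and u is sorted along
  \<open>std n u\<close> at any two places j < k, not only at neighbours.\<close>

lemma std_word_pair:
  assumes u: "u \<in> words n x" and v: "v \<in> words n y"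
  shows "std n (word_pair n x u v) = std n u \<circ> std n v"
  unfolding std_eq_iff[OF word_pair_words[OF u v]] sorts_def
proof (intro conjI ballI)
  let ?\<sigma> = "std n u" and ?\<tau> = "std n v"
  have \<sigma>: "?\<sigma> \<in> carrier (hyperoctahedral n)" and \<tau>: "?\<tau> \<in> carrier (hyperoctahedral n)"
    using std_hyperoctahedral u v by blast+
  then show "?\<sigma> \<circ> ?\<tau> \<in> carrier (hyperoctahedral n)" by (rule hyperoctahedral_comp)
  fix i assume i: "i \<in> {0..<int n}"
  define j k where "j = ?\<tau> i" and "k = ?\<tau> (i + 1)"
  have pair: "word_pair n x u v (?\<sigma> l) = int x * v l + u (?\<sigma> l)" for l
    by (simp add: word_pair_def permutes_inverses(2)[OF hyperoctahedralD(1)[OF \<sigma>]])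
  have jk: "\<bar>j\<bar> \<le> int n" "\<bar>k\<bar> \<le> int n" "k \<noteq> 0"
    using i hyperoctahedral_image[OF \<tau>] hyperoctahedral_eq_iff[OF \<tau>, of "i + 1" 0]
      hyperoctahedralD(3)[OF \<tau>] by (auto simp: j_def k_def)
  have "word_less v j k" using sorts_std[OF v] i by (simp add: sorts_def j_def k_def)
  then consider "v j < v k" | "v j = v k" "j < k" by (auto simp: word_less_def)
  then have "word_less (word_pair n x u v) (?\<sigma> j) (?\<sigma> k)"
  proof cases
    case 1
    \<comment> \<open>At j = 0 the high digit 0 may violate the parity, so the gap may be only 1;
      but then the low digit at j is 0 too, and one multiple of x outweighs the other low digit.
      Otherwise the gap is at least 2 and outweighs both.\<close>
    have "int x * v j + u (?\<sigma> j) < int x * v k + u (?\<sigma> k)"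
    proof (cases "j = 0")
      case True
      then have "int x * 1 \<le> int x * v k" using 1 words_zero[OF v] by (intro mult_left_mono) auto
      then show ?thesis
        using True words_bound[OF u pos(1), of "?\<sigma> k"] hyperoctahedralD(3)[OF \<sigma>]
          words_zero[OF u] words_zero[OF v] by auto
    next
      case False
      then have "odd (v j + int y)" "odd (v k + int y)"
        using words_parity[OF v] jk by auto
      then have "v j + 2 \<le> v k" using 1 by presburger
      then have "int x * (v j + 2) \<le> int x * v k" by (intro mult_left_mono) auto
      then show ?thesis
        using words_bound[OF u pos(1), of "?\<sigma> k"] words_bound[OF u pos(1), of "?\<sigma> j"]
        by (auto simp: algebra_simps)
    qed
    then show ?thesis by (simp add: word_less_def pair)
  next
    case 2
    then have "word_less u (?\<sigma> j) (?\<sigma> k)"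
      using jk by (intro sorts_mono[OF sorts_std[OF u] words_minus[OF u]]) auto
    then show ?thesis using 2 by (simp add: word_less_def pair)
  qed
  then show "word_less (word_pair n x u v) ((?\<sigma> \<circ> ?\<tau>) i) ((?\<sigma> \<circ> ?\<tau>) (i + 1))"
    by (simp add: j_def k_def)
qed

section \<open>Decomposition of letters into digits\<close>

text \<open>Unequal high digits differ by at least 2 and would shift the sum by at least 2x, while
  the low digits differ by less than 2x.\<close>

lemma digit_unique:
  fixes a a' b b' :: int
  assumes "int x * a + b = int x * a' + b'" "\<bar>b\<bar> < int x" "\<bar>b'\<bar> < int x" "even (a - a')"
  shows "a = a' \<and> b = b'"
proof -
  obtain c where c: "a - a' = 2 * c" using assms(4) by (rule evenE)
  have "int x * (a - a') = b' - b" using assms(1) by (simp add: algebra_simps)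
  then have *: "2 * int x * c = b' - b" by (simp add: c algebra_simps)
  have "c = 0"
  proof (rule ccontr)
    assume "c \<noteq> 0"
    then have "2 * int x * 1 \<le> 2 * int x * \<bar>c\<bar>" by (intro mult_left_mono) auto
    also have "\<dots> = \<bar>b' - b\<bar>" by (simp add: abs_mult flip: *)
    finally show False using assms(2,3) by auto
  qed
  with c * show ?thesis by auto
qed

text \<open>The letters for x y are numbered from 0 to x y - 1 by d = (c + x y - 1) / 2; dividing d
  by x with remainder gives the numbers q and r of the two digits.\<close>

lemma digit_exists:
  fixes c :: int
  assumes "\<bar>c\<bar> < int (x * y)" "odd (c + int (x * y))"
  shows "\<exists>a b. c = int x * a + b \<and> \<bar>a\<bar> < int y \<and> odd (a + int y) \<and> \<bar>b\<bar> < int x \<and> odd (b + int x)"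
proof -
  define d where "d = (c + int (x * y) - 1) div 2"
  have d: "2 * d = c + int (x * y) - 1" using assms(2) unfolding d_def by auto
  then have d_bounds: "0 \<le> d" "d < int y * int x" using assms(1) by (auto simp: mult.commute)
  define q r where "q = d div int x" and "r = d mod int x"
  have qr: "d = int x * q + r" by (simp add: q_def r_def)
  have r: "0 \<le> r" "r < int x" using pos by (auto simp: r_def)
  have "int x * q < int x * int y" using d_bounds(2) r(1) unfolding mult.commute[of "int y"] qr by linarith
  then have q: "0 \<le> q" "q < int y"
    using d_bounds(1) pos by (simp_all add: q_def pos_imp_zdiv_nonneg_iff)
  have "c = int x * (2 * q - int y + 1) + (2 * r - int x + 1)"
    using d qr by (simp add: algebra_simps)
  then show ?thesis
    using r q by (intro exI[of _ "2 * q - int y + 1"] exI[of _ "2 * r - int x + 1"]) auto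
qed

lemma bij_betw_word_pair:
  "bij_betw (\<lambda>(u, v). word_pair n x u v) (words n x \<times> words n y) (words n (x * y))"
  unfolding bij_betw_def
proof
  show "inj_on (\<lambda>(u, v). word_pair n x u v) (words n x \<times> words n y)"
  proof (rule inj_onI, clarify)
    fix u v u' v'
    assume u: "u \<in> words n x" and v: "v \<in> words n y" and u': "u' \<in> words n x"
      and v': "v' \<in> words n y" and eq: "word_pair n x u v = word_pair n x u' v'"
    let ?\<sigma> = "std n u" and ?\<sigma>' = "std n u'"
    have \<sigma>: "?\<sigma> \<in> carrier (hyperoctahedral n)" and \<sigma>': "?\<sigma>' \<in> carrier (hyperoctahedral n)"
      using std_hyperoctahedral u u' by blast+
    have digits: "v (inv' ?\<sigma> i) = v' (inv' ?\<sigma>' i) \<and> u i = u' i" if i: "i \<in> {1..int n}" for i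
    proof (rule digit_unique)
      show "int x * v (inv' ?\<sigma> i) + u i = int x * v' (inv' ?\<sigma>' i) + u' i"
        using fun_cong[OF eq, of i] by (simp add: word_pair_def)
      have "odd (w (\<rho> i) + int y)" if w: "w \<in> words n y" and \<rho>: "\<rho> \<in> carrier (hyperoctahedral n)" for w \<rho>
        using words_parity[OF w, of "\<rho> i"] hyperoctahedral_image[OF \<rho>, of i] i
          hyperoctahedral_eq_iff[OF \<rho>, of i 0] hyperoctahedralD(3)[OF \<rho>] by auto
      from this[OF v hyperoctahedral_inv[OF \<sigma>]] this[OF v' hyperoctahedral_inv[OF \<sigma>']]
      show "even (v (inv' ?\<sigma> i) - v' (inv' ?\<sigma>' i))" by auto
    qed (use words_bound u u' pos in auto)
    then have "u = u'" by (intro words_eqI[OF u u']) blast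
    \<comment> \<open>Only with equal u are the two realignments the same, so that v and v' become
      comparable.\<close>
    moreover have "v \<circ> inv' ?\<sigma> = v' \<circ> inv' ?\<sigma>"
    proof
      fix i
      have "int x * v (inv' ?\<sigma> i) = int x * v' (inv' ?\<sigma> i)"
        using fun_cong[OF eq, of i] by (simp add: word_pair_def \<open>u = u'\<close>)
      then show "(v \<circ> inv' ?\<sigma>) i = (v' \<circ> inv' ?\<sigma>) i" using pos by simp
    qed
    then have "v = v'"
      by (metis comp_assoc comp_id hyperoctahedralD(1)[OF \<sigma>] permutes_inv_o(2))
    ultimately show "u = u' \<and> v = v'" by simp
  qed
  show "(\<lambda>(u, v). word_pair n x u v) ` (words n x \<times> words n y) = words n (x * y)"
  proof (intro equalityI subsetI)
    fix w assume w: "w \<in> words n (x * y)"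
    have "\<exists>a b. w i = int x * a + b \<and> \<bar>a\<bar> < int y \<and> odd (a + int y) \<and> \<bar>b\<bar> < int x \<and> odd (b + int x)"
      if "i \<in> {1..int n}" for i
      using words_bound[OF w, of i] words_parity[OF w, of i] that pos by (intro digit_exists) auto
    then obtain a b where ab: "\<And>i. i \<in> {1..int n} \<Longrightarrow> w i = int x * a i + b i \<and> \<bar>a i\<bar> < int y \<and>
        odd (a i + int y) \<and> \<bar>b i\<bar> < int x \<and> odd (b i + int x)"
      by metis
    \<comment> \<open>The high digits of w are v realigned by the inverse of \<open>std n u\<close>;
      composing with \<open>std n u\<close> undoes this.\<close>
    define u v where "u = odd_ext n b" and "v = odd_ext n a \<circ> std n u"
    have u: "u \<in> words n x" unfolding u_def using ab by (intro odd_ext_words) blast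
    have \<sigma>: "std n u \<in> carrier (hyperoctahedral n)" using u by (rule std_hyperoctahedral)
    have a: "odd_ext n a \<in> words n y" using ab by (intro odd_ext_words) blast
    have v: "v \<in> words n y" unfolding v_def using a \<sigma> by (rule words_comp)
    have "word_pair n x u v = w"
    proof (rule words_eqI[OF word_pair_words[OF u v] w])
      fix i assume i: "i \<in> {1..int n}"
      then show "word_pair n x u v i = w i"
        using ab[OF i] permutes_inverses(1)[OF hyperoctahedralD(1)[OF \<sigma>], of i]
        by (simp add: word_pair_def v_def) (simp add: u_def odd_ext_def)
    qed
    then show "w \<in> (\<lambda>(u, v). word_pair n x u v) ` (words n x \<times> words n y)"
      using u v by force
  qed (use word_pair_words in auto)
qed

lemma conv_Phi: "conv (hyperoctahedral n) (Phi n x) (Phi n y) = Phi n (x * y)"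
proof -
  have "conv (hyperoctahedral n) (Phi n x) (Phi n y) =
      (\<Sum>u\<in>words n x. \<Sum>v\<in>words n y. of_group (std n u \<circ> std n v))"
    unfolding Phi_def conv_sum_left unfolding conv_sum_right conv_single
    by (simp add: hyperoctahedral_def)
  also have "\<dots> = (\<Sum>(u, v)\<in>words n x \<times> words n y. of_group (std n (word_pair n x u v)))"
    unfolding sum.cartesian_product by (intro sum.cong) (auto simp: std_word_pair)
  also have "\<dots> = Phi n (x * y)"
    unfolding Phi_def
    by (subst sum.reindex_bij_betw[OF bij_betw_word_pair, symmetric]) (simp add: case_prod_unfold)
  finally show ?thesis .
qed

end


section \<open>Words with a given standardisation\<close>

text \<open>With parameter m the statistics read only \<open>\<pi>\<close> at 0, ..., m, so they can
  be computed prefix by prefix. The index 0 counts in type B alone, hence the guard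
  \<open>m > 0\<close> here.\<close>

lemma des_A_Suc: "des_A (Suc m) \<pi> = des_A m \<pi> + (if m > 0 \<and> \<pi> (int m) > \<pi> (int m + 1) then 1 else 0)"
proof -
  have "{i \<in> {1..int (Suc m) - 1}. \<pi> i > \<pi> (i + 1)} = {i \<in> {1..int m - 1}. \<pi> i > \<pi> (i + 1)} \<union>
      (if m > 0 \<and> \<pi> (int m) > \<pi> (int m + 1) then {int m} else {})"
    by (auto simp: order_le_less)
  moreover have "finite {i. 1 \<le> i \<and> i < int m \<and> \<pi> (i + 1) < \<pi> i}"
    by (rule finite_subset[of _ "{1..int m}"]) auto
  ultimately show ?thesis by (simp add: des_A_def)
qed

lemma des_B_Suc: "des_B (Suc m) \<pi> = des_B m \<pi> + (if \<pi> (int m) > \<pi> (int m + 1) then 1 else 0)"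
proof -
  have "{i \<in> {0..int (Suc m) - 1}. \<pi> i > \<pi> (i + 1)} = {i \<in> {0..int m - 1}. \<pi> i > \<pi> (i + 1)} \<union>
      (if \<pi> (int m) > \<pi> (int m + 1) then {int m} else {})"
    by (auto simp: order_le_less)
  moreover have "finite {i. 0 \<le> i \<and> i < int m \<and> \<pi> (i + 1) < \<pi> i}"
    by (rule finite_subset[of _ "{0..int m}"]) auto
  ultimately show ?thesis by (simp add: des_B_def)
qed

lemma des_B_eq: "des_B (Suc m) \<pi> = des_A (Suc m) \<pi> + (if \<pi> 0 > \<pi> 1 then 1 else 0)"
proof (induction m)
  case 0
  show ?case unfolding des_A_Suc des_B_Suc by (simp add: des_A_def des_B_def)
qed (simp add: des_A_Suc[of "Suc _"] des_B_Suc[of "Suc _"])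

lemma fdes_1: "fdes 1 \<pi> = (if \<pi> 0 > \<pi> 1 then 1 else 0)"
  unfolding fdes_def One_nat_def des_A_Suc des_B_Suc by (simp add: des_A_def des_B_def)

text \<open>A descent at a positive index counts in both types, hence 2; one at 0 counts once
  (\<open>fdes_1\<close>). So all nonempty prefixes have flag descent numbers of the same
  parity.\<close>

lemma fdes_Suc: "m > 0 \<Longrightarrow> fdes (Suc m) \<pi> = fdes m \<pi> + (if \<pi> (int m) > \<pi> (int m + 1) then 2 else 0)"
  by (simp add: fdes_def des_A_Suc des_B_Suc)

lemma fdes_nat_step:
  assumes "i \<ge> 1"
  shows "int (fdes (nat (i + 1)) \<pi>) = int (fdes (nat i) \<pi>) + (if \<pi> i > \<pi> (i + 1) then 2 else 0)"
  using fdes_Suc[of "nat i" \<pi>] assms by (simp add: Suc_nat_eq_nat_zadd1 add.commute)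

lemma fdes_parity:
  assumes "1 \<le> i" "i \<le> j"
  shows "even (int (fdes (nat i) \<pi>) - int (fdes (nat j) \<pi>))"
  using assms(2)
proof (induction rule: int_ge_induct)
  case (step k)
  then show ?case using fdes_nat_step[of k \<pi>] assms(1) by auto
qed simp

lemma step_mono:
  fixes b :: "int \<Rightarrow> int"
  assumes "\<And>i. i \<in> {1..<n} \<Longrightarrow> b i \<le> b (i + 1)" "1 \<le> i" "i \<le> j" "j \<le> n"
  shows "b i \<le> b j"
proof -
  have "j \<le> n \<longrightarrow> b i \<le> b j"
    using assms(3)
  proof (induction rule: int_ge_induct)
    case (step k)
    then show ?case using assms(1)[of k] assms(2) by auto
  qed simp
  then show ?thesis using assms(4) by blast
qed

section \<open>Counting the words in a fibre of standardisation\<close>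

text \<open>With D = x - 1 - i, the size of this set is the coefficient of \<open>F_elem n i\<close>
  in \<open>Phi n x\<close>. \<open>D\<close> is an integer because this difference may be negative;
  the value 0 outside identifies functions with sequences.\<close>

definition steps :: "nat \<Rightarrow> int \<Rightarrow> (int \<Rightarrow> int) set" where
  "steps n D = {b. (\<forall>i. i \<notin> {1..int n} \<longrightarrow> b i = 0) \<and>
     (\<forall>i\<in>{1..int n}. 0 \<le> b i \<and> b i \<le> D \<and> even (b i - D)) \<and> (\<forall>i\<in>{1..<int n}. b i \<le> b (i + 1))}"

text \<open>This gives the zeros of the triangular passage from the F_i to the Phi_x, and
  \<open>steps_zero\<close> its diagonal entries 1. For n = 0 the zero function would remain for
  every \<open>D\<close>.\<close>

lemma steps_neg: "n \<ge> 1 \<Longrightarrow> D < 0 \<Longrightarrow> steps n D = {}"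
  by (force simp: steps_def dest: bspec[of _ _ 1])

lemma steps_zero: "steps n 0 = {\<lambda>_. 0}"
proof (intro equalityI subsetI)
  fix b assume b: "b \<in> steps n 0"
  have "b i = 0" for i
    using b by (cases "i \<in> {1..int n}") (auto simp: steps_def intro: antisym)
  then show "b \<in> {\<lambda>_. 0}" by auto
qed (auto simp: steps_def)

definition word_steps :: "nat \<Rightarrow> (int \<Rightarrow> int) \<Rightarrow> (int \<Rightarrow> int) \<Rightarrow> int \<Rightarrow> int" where
  "word_steps n \<pi> w i = (if i \<in> {1..int n} then w (\<pi> i) - int (fdes (nat i) \<pi>) else 0)"

definition steps_word :: "nat \<Rightarrow> (int \<Rightarrow> int) \<Rightarrow> (int \<Rightarrow> int) \<Rightarrow> int \<Rightarrow> int" where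
  "steps_word n \<pi> b = odd_ext n (\<lambda>i. b i + int (fdes (nat i) \<pi>)) \<circ> inv' \<pi>"

context
  fixes n x :: nat and \<pi> :: "int \<Rightarrow> int"
  assumes pos: "n \<ge> 1" "x > 0" and \<pi>: "\<pi> \<in> carrier (hyperoctahedral n)"
begin

lemma word_steps_in_steps:
  assumes w: "w \<in> words n x" and sorts: "sorts n w \<pi>"
  shows "word_steps n \<pi> w \<in> steps n (int x - 1 - int (fdes n \<pi>))"
proof -
  let ?b = "word_steps n \<pi> w"
  have parity: "odd (w (\<pi> i) + int x)" if "i \<in> {1..int n}" for i
    using words_parity[OF words_comp[OF w \<pi>], of i] that by auto
  have mono: "?b i \<le> ?b (i + 1)" if i: "i \<in> {1..<int n}" for i
  proof -
    have "word_less w (\<pi> i) (\<pi> (i + 1))" using sorts i by (simp add: sorts_def)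
    then consider "w (\<pi> i) < w (\<pi> (i + 1))" | "w (\<pi> i) = w (\<pi> (i + 1))" "\<pi> i < \<pi> (i + 1)"
      by (auto simp: word_less_def)
    \<comment> \<open>Distinct letters of equal parity differ by at least 2, which covers the 2
      subtracted at a descent; on a tie there is no descent.\<close>
    then show ?thesis
    proof cases
      case 1
      moreover have "odd (w (\<pi> i) + int x)" "odd (w (\<pi> (i + 1)) + int x)"
        using parity i by auto
      ultimately have "w (\<pi> i) + 2 \<le> w (\<pi> (i + 1))" by presburger
      then show ?thesis using i fdes_nat_step[of i \<pi>] by (auto simp: word_steps_def)
    qed (use i fdes_nat_step[of i \<pi>] in \<open>auto simp: word_steps_def\<close>)
  qed
  \<comment> \<open>If \<open>\<pi> 1\<close> is negative, the tie-break against position 0 fails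
    and the first letter must be positive, which covers the 1 subtracted there.\<close>
  have "word_less w (\<pi> 0) (\<pi> (0 + 1))" using sorts pos unfolding sorts_def by fastforce
  then have "0 \<le> ?b 1"
    using pos words_zero[OF w] fdes_1[of \<pi>] hyperoctahedralD(3)[OF \<pi>]
    by (auto simp: word_steps_def word_less_def)
  moreover have "?b (int n) \<le> int x - 1 - int (fdes n \<pi>)"
    using words_bound[OF w pos(2), of "\<pi> (int n)"] pos by (auto simp: word_steps_def)
  moreover have "even (?b i - (int x - 1 - int (fdes n \<pi>)))" if "i \<in> {1..int n}" for i
    using parity[OF that] fdes_parity[of i "int n" \<pi>] that by (auto simp: word_steps_def)
  ultimately have "0 \<le> ?b i \<and> ?b i \<le> int x - 1 - int (fdes n \<pi>) \<and>
      even (?b i - (int x - 1 - int (fdes n \<pi>)))" if "i \<in> {1..int n}" for i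
    using step_mono[of "int n" ?b 1 i] step_mono[of "int n" ?b i "int n"] mono that by fastforce
  then show ?thesis using mono by (auto simp: steps_def word_steps_def)
qed

text \<open>Adding the flag descent numbers back makes the sequence rise strictly at each descent,
  so ties occur only at ascents, where the tie-break agrees.\<close>

lemma steps_word_in_words:
  assumes b: "b \<in> steps n (int x - 1 - int (fdes n \<pi>))"
  shows "steps_word n \<pi> b \<in> words n x" "sorts n (steps_word n \<pi> b) \<pi>"
proof -
  define a where "a i = b i + int (fdes (nat i) \<pi>)" for i
  have step: "a i + (if \<pi> i > \<pi> (i + 1) then 2 else 0) \<le> a (i + 1)" if "i \<in> {1..<int n}" for i
  proof -
    have "b i \<le> b (i + 1)" using b that by (simp add: steps_def)
    moreover have "i \<ge> 1" using that by simp
    ultimately show ?thesis unfolding a_def fdes_nat_step[OF \<open>i \<ge> 1\<close>] by linarith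
  qed
  have step': "a i \<le> a (i + 1)" if "i \<in> {1..<int n}" for i
    using step[OF that] by (simp split: if_splits)
  have "a i \<le> a (int n)" if "i \<in> {1..int n}" for i
    using that by (auto intro: step_mono[of "int n" a, OF step'])
  moreover have "a (int n) \<le> int x - 1"
  proof -
    have "int n \<in> {1..int n}" using pos by simp
    then have "b (int n) \<le> int x - 1 - int (fdes n \<pi>)" using b unfolding steps_def by blast
    then show ?thesis by (simp add: a_def)
  qed
  moreover have "0 \<le> a i \<and> odd (a i + int x)" if "i \<in> {1..int n}" for i
  proof -
    have "0 \<le> b i" "even (b i - (int x - 1 - int (fdes n \<pi>)))" using b that by (auto simp: steps_def)
    then show ?thesis using fdes_parity[of i "int n" \<pi>] that by (auto simp: a_def)
  qed
  ultimately have "odd_ext n a \<in> words n x"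
    by (intro odd_ext_words) fastforce
  then show "steps_word n \<pi> b \<in> words n x"
    unfolding steps_word_def a_def using hyperoctahedral_inv[OF \<pi>] by (rule words_comp)
  have eq: "steps_word n \<pi> b (\<pi> i) = odd_ext n a i" for i
    by (simp add: steps_word_def a_def[abs_def] permutes_inverses(2)[OF hyperoctahedralD(1)[OF \<pi>]])
  show "sorts n (steps_word n \<pi> b) \<pi>"
    unfolding sorts_def word_less_def eq
  proof (intro conjI ballI \<pi>)
    fix i assume i: "i \<in> {0..<int n}"
    have ne: "\<pi> i \<noteq> \<pi> (i + 1)" by (simp add: hyperoctahedral_eq_iff[OF \<pi>])
    show "odd_ext n a i < odd_ext n a (i + 1) \<or>
        odd_ext n a i = odd_ext n a (i + 1) \<and> \<pi> i < \<pi> (i + 1)"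
    proof (cases "i = 0")
      case True
      \<comment> \<open>At place 0 the extension has its default value 0, so the comparison is
        between 0 and \<open>a 1\<close>, which exceeds \<open>b 1\<close> by 1 if
        \<open>\<pi> 1\<close> is negative.\<close>
      have "0 \<le> b 1" using b pos by (auto simp: steps_def)
      then show ?thesis
        using True ne pos fdes_1[of \<pi>] by (auto simp: odd_ext_def a_def)
    next
      case False
      then show ?thesis using step[of i] i ne by (auto simp: odd_ext_def split: if_splits)
    qed
  qed
qed

text \<open>The two maps above are mutually inverse. The point is that the count depends on
  \<open>\<pi>\<close> only through \<open>fdes n \<pi>\<close>.\<close>

lemma card_std_fibre:
  "card {w \<in> words n x. std n w = \<pi>} = card (steps n (int x - 1 - int (fdes n \<pi>)))"
proof (rule bij_betw_same_card[of "word_steps n \<pi>"], rule bij_betwI[where g = "steps_word n \<pi>"])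
  show "word_steps n \<pi> \<in> {w \<in> words n x. std n w = \<pi>} \<rightarrow> steps n (int x - 1 - int (fdes n \<pi>))"
    using word_steps_in_steps std_eq_iff by blast
  show "steps_word n \<pi> \<in> steps n (int x - 1 - int (fdes n \<pi>)) \<rightarrow> {w \<in> words n x. std n w = \<pi>}"
    using steps_word_in_words std_eq_iff by blast
next
  fix w assume w: "w \<in> {w \<in> words n x. std n w = \<pi>}"
  then have "w \<circ> \<pi> \<in> words n x" using words_comp \<pi> by blast
  then have "odd_ext n (\<lambda>i. word_steps n \<pi> w i + int (fdes (nat i) \<pi>)) = w \<circ> \<pi>"
    by (intro odd_ext_eq) (auto simp: word_steps_def)
  then have "steps_word n \<pi> (word_steps n \<pi> w) = (w \<circ> \<pi>) \<circ> inv' \<pi>" by (simp add: steps_word_def)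
  also have "\<dots> = w" by (simp only: comp_assoc permutes_inv_o(1)[OF hyperoctahedralD(1)[OF \<pi>]] comp_id)
  finally show "steps_word n \<pi> (word_steps n \<pi> w) = w" .
next
  fix b assume "b \<in> steps n (int x - 1 - int (fdes n \<pi>))"
  then show "word_steps n \<pi> (steps_word n \<pi> b) = b"
    by (intro ext) (auto simp: word_steps_def steps_word_def odd_ext_def steps_def
        permutes_inverses(2)[OF hyperoctahedralD(1)[OF \<pi>]])
qed

end


section \<open>Relations between the descent statistics\<close>

lemma fdes_le:
  assumes "n \<ge> 1"
  shows "fdes n \<pi> \<le> 2 * n - 1"
proof -
  have "des_A n \<pi> \<le> card {1..int n - 1}" "des_B n \<pi> \<le> card {0..int n - 1}"
    unfolding des_A_def des_B_def by (intro card_mono; auto)+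
  then show ?thesis using assms by (simp add: fdes_def)
qed

text \<open>Type B exceeds type A by 0 or 1, so the sum of the two determines each of them.\<close>

lemma des_A_fdes: "n \<ge> 1 \<Longrightarrow> des_A n \<pi> = fdes n \<pi> div 2"
  and des_B_fdes: "n \<ge> 1 \<Longrightarrow> des_B n \<pi> = (fdes n \<pi> + 1) div 2"
  using des_B_eq[of "n - 1" \<pi>] by (auto simp: fdes_def)

lemma qscale_single: "qscale c (Poly_Mapping.single g a) = Poly_Mapping.single g (c * a)"
  by (rule poly_mapping_eqI) (simp add: lookup_qscale lookup_single when_def)

section \<open>The flag descent algebra\<close>

text \<open>Words are grouped by standardisation, then permutations by flag descent number; on each
  class the fibres have equal size by \<open>card_std_fibre\<close>.\<close>

lemma Phi_eq:
  assumes "n \<ge> 1" "x > 0"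
  shows "Phi n x = (\<Sum>i\<in>{0..2 * n - 1}.
    qscale (of_nat (card (steps n (int x - 1 - int i)))) (F_elem n i))"
proof -
  let ?C = "carrier (hyperoctahedral n)" and ?c = "\<lambda>i. of_nat (card (steps n (int x - 1 - int i)))"
  have "Phi n x = (\<Sum>\<pi>\<in>?C. \<Sum>w | w \<in> words n x \<and> std n w = \<pi>. of_group (std n w))"
    unfolding Phi_def
    by (rule sum.group[symmetric]) (auto simp: finite_words finite_hyperoctahedral std_hyperoctahedral)
  also have "\<dots> = (\<Sum>\<pi>\<in>?C. qscale (?c (fdes n \<pi>)) (of_group \<pi>))"
  proof (rule sum.cong[OF refl])
    fix \<pi> assume \<pi>: "\<pi> \<in> ?C"
    have "(\<Sum>w | w \<in> words n x \<and> std n w = \<pi>. of_group (std n w)) =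
        (\<Sum>w | w \<in> words n x \<and> std n w = \<pi>. qscale 1 (of_group \<pi>))"
      by (rule sum.cong) auto
    also have "\<dots> = qscale (of_nat (card {w \<in> words n x. std n w = \<pi>})) (of_group \<pi>)"
      unfolding qvs.scale_sum_left[symmetric] by simp
    finally show "(\<Sum>w | w \<in> words n x \<and> std n w = \<pi>. of_group (std n w)) =
        qscale (?c (fdes n \<pi>)) (of_group \<pi>)"
      unfolding card_std_fibre[OF assms \<pi>] .
  qed
  also have "\<dots> = (\<Sum>i\<in>{0..2 * n - 1}. \<Sum>\<pi> | \<pi> \<in> ?C \<and> fdes n \<pi> = i.
      qscale (?c (fdes n \<pi>)) (of_group \<pi>))"
    using fdes_le[OF assms(1)]
    by (intro sum.group[symmetric]) (auto simp: finite_hyperoctahedral)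
  also have "\<dots> = (\<Sum>i\<in>{0..2 * n - 1}. qscale (?c i) (F_elem n i))"
    unfolding F_elem_def qvs.scale_sum_right by (intro sum.cong) auto
  finally show ?thesis .
qed

lemma Phi_in_span_F: "n \<ge> 1 \<Longrightarrow> x > 0 \<Longrightarrow> Phi n x \<in> qvs.span (F_elem n ` {0..2 * n - 1})"
  by (auto simp: Phi_eq intro: qvs.span_sum qvs.span_scale qvs.span_base)

text \<open>Triangular inversion: in \<open>Phi n (Suc i)\<close> the coefficient of F_j is 0 for j
  > i and 1 for j = i, so F_i is this element minus a combination of earlier F_j.\<close>

lemma F_in_span_Phi:
  assumes "n \<ge> 1" "i \<le> 2 * n - 1"
  shows "F_elem n i \<in> qvs.span (Phi n ` {0<..})"
  using assms(2)
proof (induction i rule: less_induct)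
  case (less i)
  let ?t = "\<lambda>j. qscale (of_nat (card (steps n (int (Suc i) - 1 - int j)))) (F_elem n j)"
  have "Phi n (Suc i) = (\<Sum>j\<in>{0..2 * n - 1}. ?t j)"
    using assms(1) by (intro Phi_eq) auto
  also have "\<dots> = (\<Sum>j\<in>{0..i}. ?t j)"
    using less.prems assms(1) by (intro sum.mono_neutral_right) (auto simp: steps_neg)
  also have "\<dots> = F_elem n i + (\<Sum>j\<in>{0..<i}. ?t j)"
    by (simp add: sum.last_plus steps_zero)
  finally have "F_elem n i = Phi n (Suc i) - (\<Sum>j\<in>{0..<i}. ?t j)" by simp
  moreover have "(\<Sum>j\<in>{0..<i}. ?t j) \<in> qvs.span (Phi n ` {0<..})"
    using less by (intro qvs.span_sum qvs.span_scale less.IH) auto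
  ultimately show ?case by (auto intro: qvs.span_diff qvs.span_base)
qed

lemma span_F_eq_span_Phi:
  "n \<ge> 1 \<Longrightarrow> qvs.span (F_elem n ` {0..2 * n - 1}) = qvs.span (Phi n ` {0<..})"
  unfolding qvs.span_eq using Phi_in_span_F F_in_span_Phi by auto

section \<open>Bilinearity and subalgebras given by spans\<close>

lemma conv_qscale_left: "conv G (qscale c x) y = qscale c (conv G x y)"
proof -
  have "Poly_Mapping.keys (qscale c x) \<subseteq> Poly_Mapping.keys x"
    by (auto simp: in_keys_iff lookup_qscale)
  then show ?thesis
    by (simp add: conv_superset[where A = "Poly_Mapping.keys x" and B = "Poly_Mapping.keys y"]
        qvs.scale_sum_right qscale_single lookup_qscale mult.assoc)
qed

lemma conv_qscale_right: "conv G x (qscale c y) = qscale c (conv G x y)"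
proof -
  have "Poly_Mapping.keys (qscale c y) \<subseteq> Poly_Mapping.keys y"
    by (auto simp: in_keys_iff lookup_qscale)
  then show ?thesis
    by (simp add: conv_superset[where A = "Poly_Mapping.keys x" and B = "Poly_Mapping.keys y"]
        qvs.scale_sum_right qscale_single lookup_qscale mult.left_commute)
qed

text \<open>By bilinearity closure need only hold for generators: span induction on the left factor,
  then on the right one.\<close>

lemma conv_in_span:
  assumes "x \<in> qvs.span X" "y \<in> qvs.span X"
    and closed: "\<And>x y. x \<in> X \<Longrightarrow> y \<in> X \<Longrightarrow> conv G x y \<in> qvs.span X"
  shows "conv G x y \<in> qvs.span X"
  using assms(1)
proof (induction rule: qvs.span_induct)
  case base
  show ?case
    by (rule qvs.subspaceI)
      (auto simp: conv_add_left conv_qscale_left qvs.span_zero qvs.span_add qvs.span_scale)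
next
  case (step x)
  show ?case
    using assms(2)
  proof (induction rule: qvs.span_induct)
    case base
    show ?case
      by (rule qvs.subspaceI)
        (auto simp: conv_add_right conv_qscale_right qvs.span_zero qvs.span_add qvs.span_scale)
  next
    case (step y)
    then show ?case using \<open>x \<in> X\<close> closed by blast
  qed
qed

lemma ga_subalgebra_span:
  assumes G: "group G" and X: "\<And>x. x \<in> X \<Longrightarrow> Poly_Mapping.keys x \<subseteq> carrier G"
    and one: "of_group \<one>\<^bsub>G\<^esub> \<in> qvs.span X"
    and closed: "\<And>x y. x \<in> X \<Longrightarrow> y \<in> X \<Longrightarrow> conv G x y \<in> qvs.span X"
  shows "ga_subalgebra G (qvs.span X)"
proof -
  interpret ring "group_algebra G" using G by (rule ring_group_algebra)
  have carrier: "qvs.span X \<subseteq> carrier (group_algebra G)"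
  proof (rule qvs.span_minimal)
    show "qvs.subspace (carrier (group_algebra G))"
      by (rule qvs.subspaceI)
        (auto simp: group_algebra_def in_keys_iff lookup_add lookup_qscale subset_iff,
          metis add.right_neutral)
  qed (use X in \<open>auto simp: group_algebra_def\<close>)
  show ?thesis
    unfolding ga_subalgebra_def
  proof (intro conjI subringI carrier qvs.subspace_span)
    fix h assume h: "h \<in> qvs.span X"
    then have "- h \<in> qvs.span X" by (rule qvs.span_neg)
    \<comment> \<open>The additive inverse of the ring is fixed by uniqueness within the carrier,
      which identifies it with pointwise negation.\<close>
    then have "- h = \<ominus>\<^bsub>group_algebra G\<^esub> h"
      using h carrier by (intro minus_equality[symmetric]) (auto simp: group_algebra_def)
    with \<open>- h \<in> qvs.span X\<close> show "\<ominus>\<^bsub>group_algebra G\<^esub> h \<in> qvs.span X" by simp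
  next
    fix x y assume "x \<in> qvs.span X" "y \<in> qvs.span X"
    then show "x \<otimes>\<^bsub>group_algebra G\<^esub> y \<in> qvs.span X" "x \<oplus>\<^bsub>group_algebra G\<^esub> y \<in> qvs.span X"
      using conv_in_span[OF _ _ closed] by (auto simp: group_algebra_def qvs.span_add)
  qed (use one in \<open>simp add: group_algebra_def\<close>)
qed

lemma keys_Phi: "Poly_Mapping.keys (Phi n x) \<subseteq> carrier (hyperoctahedral n)"
  unfolding Phi_def
  by (rule order_trans[OF keys_sum]) (auto simp: std_hyperoctahedral split: if_splits)

lemma words_1: "words n 1 = {\<lambda>_. 0}"
proof (intro equalityI subsetI)
  fix w assume w: "w \<in> words n 1"
  have "w i = 0" for i using words_bound[OF w, of i] by simp
  then show "w \<in> {\<lambda>_. 0}" by auto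
qed (auto simp: words_def)

text \<open>The zero word is the only word for x = 1; all its ties are broken by position, so the
  identity sorts it.\<close>

lemma Phi_1: "Phi n 1 = of_group id"
proof -
  have "sorts n (\<lambda>_. 0) id" by (auto simp: sorts_def word_less_def hyperoctahedral_def)
  then have "std n (\<lambda>_. 0) = id" by (subst std_eq_iff[of _ n 1]) (simp_all add: words_1 del: One_nat_def)
  then show ?thesis unfolding Phi_def words_1 by simp
qed

text \<open>Positive numbers are closed under multiplication, so by \<open>conv_Phi\<close> a
  product of generators is again a generator.\<close>

lemma ga_subalgebra_Phi: "ga_subalgebra (hyperoctahedral n) (qvs.span (Phi n ` {0<..}))"
proof (rule ga_subalgebra_span[OF group_hyperoctahedral])
  have "Phi n 1 \<in> qvs.span (Phi n ` {0<..})" by (intro qvs.span_base) auto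
  then show "of_group \<one>\<^bsub>hyperoctahedral n\<^esub> \<in> qvs.span (Phi n ` {0<..})"
    by (simp only: Phi_1) (simp add: hyperoctahedral_def)
qed (use keys_Phi in \<open>auto simp: conv_Phi intro!: qvs.span_base\<close>)

section \<open>Linear independence of the F_i\<close>

text \<open>
  The descents of \<open>flip a b\<close> are exactly \<open>a, \<dots>, b - 1\<close>, so suitable \<open>a\<close> and \<open>b\<close> realise every flag descent number.
\<close>

definition flip :: "nat \<Rightarrow> nat \<Rightarrow> int \<Rightarrow> int" where
  "flip a b j = (if int a < \<bar>j\<bar> \<and> \<bar>j\<bar> \<le> int b then - j else j)"

lemma flip_hyperoctahedral:
  assumes "b \<le> n"
  shows "flip a b \<in> carrier (hyperoctahedral n)"
proof (rule hyperoctahedralI)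
  have "flip a b (flip a b j) = j" for j by (auto simp: flip_def)
  then have "\<exists>!i. flip a b i = j" for j by metis
  then show "flip a b permutes {- int n..int n}"
    using assms by (auto simp: permutes_def flip_def)
qed (simp add: flip_def)

text \<open>For a < b the values on 0, 1, 2, ... climb to a, then fall through -(a + 1), ..., -b,
  and climb again from b + 1 on.\<close>

lemma flip_descent: "i \<ge> 0 \<Longrightarrow> flip a b i > flip a b (i + 1) \<longleftrightarrow> i \<in> {int a..<int b}"
  by (auto simp: flip_def)

lemma exists_fdes:
  assumes "i < 2 * n"
  shows "\<exists>\<pi>\<in>carrier (hyperoctahedral n). fdes n \<pi> = i"
proof -
  have A: "des_A n (flip a b) = card ({1..int n - 1} \<inter> {int a..<int b})" for a b
    unfolding des_A_def by (rule arg_cong[of _ _ card]) (auto simp: flip_descent)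
  have B: "des_B n (flip a b) = card ({0..int n - 1} \<inter> {int a..<int b})" for a b
    unfolding des_B_def by (rule arg_cong[of _ _ card]) (auto simp: flip_descent)
  obtain k where k: "i = 2 * k \<or> i = 2 * k + 1" by (meson oddE evenE)
  then have "k < n" using assms by auto
  show ?thesis
    using k
  proof
    \<comment> \<open>The k descents n - k, ..., n - 1 avoid 0 because k < n, so each counts
      twice.\<close>
    assume i: "i = 2 * k"
    have "{1..int n - 1} \<inter> {int (n - k)..<int n} = {int (n - k)..<int n}"
      "{0..int n - 1} \<inter> {int (n - k)..<int n} = {int (n - k)..<int n}"
      using \<open>k < n\<close> by auto
    then have "fdes n (flip (n - k) n) = i"
      using \<open>k < n\<close> unfolding fdes_def A B by (simp add: i of_nat_diff)
    then show ?thesis using flip_hyperoctahedral[of n n "n - k"] by blast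
  next
    \<comment> \<open>The descents are 0, ..., k; the one at 0 counts once and the other k count
      twice.\<close>
    assume i: "i = 2 * k + 1"
    have "{1..int n - 1} \<inter> {int 0..<int (Suc k)} = {1..int k}"
      "{0..int n - 1} \<inter> {int 0..<int (Suc k)} = {0..int k}"
      using \<open>k < n\<close> by auto
    then have "fdes n (flip 0 (Suc k)) = i" unfolding fdes_def A B by (simp add: i)
    then show ?thesis using flip_hyperoctahedral[of "Suc k" n 0] \<open>k < n\<close> by auto
  qed
qed

lemma lookup_F_elem:
  "Poly_Mapping.lookup (F_elem n i) \<pi> =
     (if \<pi> \<in> carrier (hyperoctahedral n) \<and> fdes n \<pi> = i then 1 else 0)"
  by (auto simp: F_elem_def lookup_sum lookup_single when_def finite_hyperoctahedral)

text \<open>A permutation with flag descent number i has coefficient 1 in F_i and 0 in every other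
  F_j; reading off this coefficient separates the family and isolates each scalar of a linear
  relation.\<close>

lemma basis_family_F:
  assumes "n \<ge> 1"
  shows "basis_family (F_elem n) {0..2 * n - 1} (qvs.span (F_elem n ` {0..2 * n - 1}))"
proof -
  let ?I = "{0..2 * n - 1}"
  have witness: "\<exists>\<pi>. \<forall>j. Poly_Mapping.lookup (F_elem n j) \<pi> = (if j = i then 1 else 0)" if "i \<in> ?I" for i
  proof -
    have "i < 2 * n" using that assms by auto
    from exists_fdes[OF this] show ?thesis by (auto simp: lookup_F_elem)
  qed
  have inj: "inj_on (F_elem n) ?I"
    using witness by (intro inj_onI) (metis zero_neq_one)
  have "qvs.independent (F_elem n ` ?I)"
  proof (rule qvs.independent_if_scalars_zero)
    fix c v assume 0: "(\<Sum>v\<in>F_elem n ` ?I. qscale (c v) v) = 0" and "v \<in> F_elem n ` ?I"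
    then obtain i where i: "i \<in> ?I" "v = F_elem n i" by blast
    obtain \<pi> where \<pi>: "\<forall>j. Poly_Mapping.lookup (F_elem n j) \<pi> = (if j = i then 1 else 0)"
      using witness[OF i(1)] by blast
    have "0 = Poly_Mapping.lookup (\<Sum>j\<in>?I. qscale (c (F_elem n j)) (F_elem n j)) \<pi>"
      using 0 unfolding sum.reindex[OF inj] by (simp add: o_def)
    also have "\<dots> = (\<Sum>j\<in>?I. if j = i then c (F_elem n j) else 0)"
      unfolding lookup_sum lookup_qscale using \<pi> by (intro sum.cong) auto
    also have "\<dots> = c v" using i by (simp add: sum.delta)
    finally show "c v = 0" by simp
  qed simp
  with inj show ?thesis by (simp add: basis_family_def)
qed

section \<open>The Eulerian elements of types A and B\<close>

lemma A_elem_eq: "n \<ge> 1 \<Longrightarrow> A_elem n k = F_elem n (2 * k) + F_elem n (2 * k + 1)"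
proof -
  assume n: "n \<ge> 1"
  have "{\<pi> \<in> carrier (hyperoctahedral n). des_A n \<pi> = k} =
      {\<pi> \<in> carrier (hyperoctahedral n). fdes n \<pi> = 2 * k} \<union>
      {\<pi> \<in> carrier (hyperoctahedral n). fdes n \<pi> = 2 * k + 1}"
    by (auto simp: des_A_fdes[OF n])
  then show ?thesis unfolding A_elem_def F_elem_def
    by (simp only:) (rule sum.union_disjoint, auto simp: finite_hyperoctahedral)
qed

text \<open>At k = 0 the term with index 2k - 1 is absent; truncated subtraction would count
  \<open>F_elem n 0\<close> twice.\<close>

lemma B_elem_0: "n \<ge> 1 \<Longrightarrow> B_elem n 0 = F_elem n 0"
  unfolding B_elem_def F_elem_def by (rule sum.cong) (auto simp: des_B_fdes)

lemma B_elem_Suc: "n \<ge> 1 \<Longrightarrow> B_elem n (Suc k) = F_elem n (2 * k + 1) + F_elem n (2 * k + 2)"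
proof -
  assume n: "n \<ge> 1"
  have "{\<pi> \<in> carrier (hyperoctahedral n). des_B n \<pi> = Suc k} =
      {\<pi> \<in> carrier (hyperoctahedral n). fdes n \<pi> = 2 * k + 1} \<union>
      {\<pi> \<in> carrier (hyperoctahedral n). fdes n \<pi> = 2 * k + 2}"
    by (auto simp: des_B_fdes[OF n])
  then show ?thesis unfolding B_elem_def F_elem_def
    by (simp only:) (rule sum.union_disjoint, auto simp: finite_hyperoctahedral)
qed

text \<open>This handles the index 2n, just outside the basis, which occurs in
  \<open>B_elem n n\<close>.\<close>

lemma F_elem_eq_0: "n \<ge> 1 \<Longrightarrow> i > 2 * n - 1 \<Longrightarrow> F_elem n i = 0"
  unfolding F_elem_def using fdes_le[of n]
  by (intro sum.neutral ballI) (metis (mono_tags, lifting) mem_Collect_eq not_le)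

lemma span_F_eq_span_AB:
  assumes n: "n \<ge> 1"
  shows "qvs.span (F_elem n ` {0..2 * n - 1}) = qvs.span (A_elem n ` {0..n - 1} \<union> B_elem n ` {0..n})"
proof -
  let ?F = "qvs.span (F_elem n ` {0..2 * n - 1})"
  let ?AB = "qvs.span (A_elem n ` {0..n - 1} \<union> B_elem n ` {0..n})"
  have F: "F_elem n i \<in> ?F" for i
    using F_elem_eq_0[OF n, of i]
    by (cases "i \<le> 2 * n - 1") (auto intro: qvs.span_base qvs.span_zero)
  have "A_elem n k \<in> ?F" for k by (simp only: A_elem_eq[OF n] F qvs.span_add)
  moreover have "B_elem n k \<in> ?F" for k
    by (cases k) (simp_all only: B_elem_0[OF n] B_elem_Suc[OF n] F qvs.span_add)
  \<comment> \<open>The F_i are recovered in turn: F_0 = B_0, then F_{2k+1} = A_k - F_{2k} and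
    F_{2k+2} = B_{k+1} - F_{2k+1}.\<close>
  moreover have "F_elem n i \<in> ?AB" if "i \<le> 2 * n - 1" for i
    using that
  proof (induction i)
    case 0
    show ?case unfolding B_elem_0[OF n, symmetric] by (intro qvs.span_base) auto
  next
    case (Suc i)
    then have F_i: "F_elem n i \<in> ?AB" by simp
    obtain k where "i = 2 * k \<or> i = 2 * k + 1" by (meson oddE evenE)
    then show ?case
    proof
      assume i: "i = 2 * k"
      then have "A_elem n k \<in> ?AB" using Suc.prems by (intro qvs.span_base) auto
      then have "A_elem n k - F_elem n i \<in> ?AB" using F_i by (rule qvs.span_diff)
      then show ?thesis by (simp add: A_elem_eq[OF n] i)
    next
      assume i: "i = 2 * k + 1"
      then have "B_elem n (Suc k) \<in> ?AB" using Suc.prems by (intro qvs.span_base) auto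
      then have "B_elem n (Suc k) - F_elem n i \<in> ?AB" using F_i by (rule qvs.span_diff)
      then show ?thesis by (simp add: B_elem_Suc[OF n] i)
    qed
  qed
  ultimately show ?thesis unfolding qvs.span_eq by auto
qed

theorem mainTheorem3:
  fixes n :: nat
  assumes "n \<ge> 1"
  shows "\<exists>S. ga_subalgebra (hyperoctahedral n) S \<and>
             basis_family (F_elem n) {0..2 * n - 1} S \<and>
             S = qvs.span (A_elem n ` {0..n - 1} \<union> B_elem n ` {0..n})"
  \<comment> \<open>The witness is the span of the \<open>Phi n x\<close>, into which the span of
    the F_i is rewritten.\<close>
  using ga_subalgebra_Phi[of n] basis_family_F[OF assms] span_F_eq_span_AB[OF assms]
  unfolding span_F_eq_span_Phi[OF assms] by blast

end
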